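(* Let $X$ be a partially ordered normed space whose ordering cone $\mathcal{C}$ is closed, convex and pointed, let $x_0\in A\subset X$, $\varepsilon\ge0$, and $D\in\overline{\mathcal{H}}$. Assume that $(-\mathcal{C},\ \overline{\mathrm{cone}}(A-x_0+D(\varepsilon)))$ has the strict separation property (SSP). If $x_0\in\mathrm{Be}(A,\mathcal{C},D,\varepsilon)$, then there exists $(f,\alpha)\in\mathcal{C}^{a\#}_+$ such that: (i) $\min_{x\in(A+D(\varepsilon))\cup\{x_0\}}\ f(x-x_0)+\alpha\|x-x_0\|$ is attained only at $x_0$; (ii) $x_0\in\mathrm{AMin}(g_{(f,\alpha,x_0)},A,\lambda)$ for $\lambda=\inf_{d\in D(\varepsilon)} \big(f(d)+\alpha\|d\|\big)$.
   Context: $X$ is a real normed space with origin $0_X$, dual $X^*$ and unit sphere $S_X$. For $S\subset X$: $\overline S$ is the closure, $\mathrm{bd}(S)$ the boundary, $\mathrm{co}(S)$ the convex hull, $S_0:=S\cup\{0_X\}$, $\mathrm{cone}(S):=\{\lambda s:\lambda\ge0,\ s\in S\}$ and $\overline{\mathrm{cone}}(S)$ is its closure. A cone is a set closed under multiplication by all $\lambda\ge0$; all cones considered are assumed non-trivial (different from $\{0_X\}$ and $X$). Pointed means $(-\mathcal{C})\cap\mathcal{C}=\{0_X\}$. For non-empty $D\subset X\setminus\{0_X\}$: $D(\varepsilon):=\varepsilon D$ if $\varepsilon>0$, and $D(0):=\mathrm{cone}(D)\setminus\{0_X\}$. $\overline{\mathcal{H}}:=\{\emptyset\ne D\subset X\setminus\{0_X\}:\overline{\mathrm{cone}}(D)\cap(-\mathcal{C})=\{0_X\}\}$.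 $x_0\in\mathrm{Be}(A,\mathcal{C},D,\varepsilon)$ (Benson $(D,\varepsilon)$-efficient point) means $x_0\in A$ and $\overline{\mathrm{cone}}(A+D(\varepsilon)-x_0)\cap(-\mathcal{C})=\{0_X\}$. $g_{(f,\alpha,x_0)}(x):=f(x-x_0)+\alpha\|x-x_0\|$ for $x\in X$. For $g:X\to\mathbb{R}$, $\emptyset\neq A\subset X$ and $\lambda\ge0$, $\mathrm{AMin}(g,A,\lambda):=\{x\in A: g(x)-\lambda\le g(z)\ \forall z\in A\}$. For a cone $\mathcal{C}$, $\mathcal{C}_{\wedge}:=\mathrm{co}(\mathcal{C}\cap S_X)$ and $\mathcal{C}_{\vee}:=\mathrm{co}((\mathrm{bd}(\mathcal{C})\cap S_X)_0)$. The pair of cones $(\mathcal{C},\mathcal{K})$ has the strict separation property (SSP) if $0_X\notin\overline{\mathcal{C}_{\wedge}-\mathcal{K}_{\vee}}$ (Minkowski difference). $\mathcal{C}^{\#}:=\{f\in X^*: f(x)>0\ \forall x\in\mathcal{C},\ x\neq0_X\}$ and $\mathcal{C}^{a\#}_+:=\{(f,\alpha)\in\mathcal{C}^{\#}\times(0,\infty): f(x)-\alpha\|x\|>0\ \forall x\in\mathcal{C},\ x\neq0_X\}$. *)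

theory Defs
  imports "HOL-Analysis.Analysis"
begin

text \<open>
  The space \<open>X\<close> is a type of class \<open>real_normed_vector\<close> and its dual is the type
  \<open>'a \<Rightarrow>\<^sub>L real\<close> of bounded linear functionals. The set \<open>cone(S)\<close> is \<open>cone hull S\<close>
  (see \<open>cone_hull_expl\<close>), the boundary is \<open>frontier\<close>, and \<open>A + B\<close> on sets is the Minkowski
  sum of \<open>Set_Algebras\<close>. Since \<open>-\<close> on sets is the set-theoretic difference or complement,
  \<open>-C\<close> is written \<open>uminus ` C\<close>.
\<close>

definition nontrivial_cone :: "'a::real_normed_vector set \<Rightarrow> bool" where
  "nontrivial_cone C \<longleftrightarrow> cone C \<and> C \<noteq> {} \<and> C \<noteq> {0} \<and> C \<noteq> UNIV"

definition pointed :: "'a::real_normed_vector set \<Rightarrow> bool" where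
  "pointed C \<longleftrightarrow> uminus ` C \<inter> C = {0}"

text \<open>\<open>D(\<epsilon>)\<close>; only used for \<open>\<epsilon> \<ge> 0\<close>.\<close>

definition dil :: "'a::real_normed_vector set \<Rightarrow> real \<Rightarrow> 'a set" where
  "dil D \<epsilon> = (if \<epsilon> = 0 then (cone hull D) - {0} else (\<lambda>d. \<epsilon> *\<^sub>R d) ` D)"

definition H_bar :: "'a::real_normed_vector set \<Rightarrow> 'a set set" where
  "H_bar C = {D. D \<noteq> {} \<and> D \<subseteq> UNIV - {0} \<and> closure (cone hull D) \<inter> uminus ` C = {0}}"

definition Be ::
  "'a::real_normed_vector set \<Rightarrow> 'a set \<Rightarrow> 'a set \<Rightarrow> real \<Rightarrow> 'a set" where
  "Be A C D \<epsilon> = {x\<^sub>0 \<in> A.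
     closure (cone hull ((\<lambda>y. y - x\<^sub>0) ` (A + dil D \<epsilon>))) \<inter> uminus ` C = {0}}"

definition g_fun :: "('a::real_normed_vector \<Rightarrow>\<^sub>L real) \<Rightarrow> real \<Rightarrow> 'a \<Rightarrow> 'a \<Rightarrow> real" where
  "g_fun f \<alpha> x\<^sub>0 x = blinfun_apply f (x - x\<^sub>0) + \<alpha> * norm (x - x\<^sub>0)"

definition AMin :: "('a \<Rightarrow> real) \<Rightarrow> 'a set \<Rightarrow> real \<Rightarrow> 'a set" where
  "AMin g A lam = {x \<in> A. \<forall>z\<in>A. g x - lam \<le> g z}"

definition wedge_part :: "'a::real_normed_vector set \<Rightarrow> 'a set" where
  "wedge_part C = convex hull (C \<inter> sphere 0 1)"

definition vee_part :: "'a::real_normed_vector set \<Rightarrow> 'a set" where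
  "vee_part C = convex hull (insert 0 (frontier C \<inter> sphere 0 1))"

definition SSP :: "'a::real_normed_vector set \<Rightarrow> 'a set \<Rightarrow> bool" where
  "SSP C K \<longleftrightarrow> 0 \<notin> closure {a - b | a b. a \<in> wedge_part C \<and> b \<in> vee_part K}"

definition dual_sharp :: "'a::real_normed_vector set \<Rightarrow> ('a \<Rightarrow>\<^sub>L real) set" where
  "dual_sharp C = {f. \<forall>x\<in>C. x \<noteq> 0 \<longrightarrow> 0 < blinfun_apply f x}"

definition aug_dual_sharp ::
  "'a::real_normed_vector set \<Rightarrow> (('a \<Rightarrow>\<^sub>L real) \<times> real) set" where
  "aug_dual_sharp C = {(f, \<alpha>). f \<in> dual_sharp C \<and> 0 < \<alpha> \<and>
     (\<forall>x\<in>C. x \<noteq> 0 \<longrightarrow> 0 < blinfun_apply f x - \<alpha> * norm x)}"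

end

theory Submission
  imports Defs
begin

text \<open>
  Strict separation yields a continuous linear \<open>f\<close> and \<open>\<delta> > 0\<close> with \<open>f w + \<delta> \<le> f v\<close> for all \<open>w\<close>
  in \<open>co(-C \<inter> S)\<close> and \<open>v\<close> in \<open>co((bd K \<inter> S)\<^sub>0)\<close>, where \<open>K\<close> is the closed cone generated by
  \<open>A - x\<^sub>0 + D(\<epsilon>)\<close> and \<open>S\<close> is the unit sphere. A suitable level \<open>-\<alpha>\<close> strictly between the two sides
  gives \<open>f + \<alpha>\<parallel>\<cdot>\<parallel> < 0\<close> on \<open>-C\<close> and \<open>> 0\<close> on \<open>bd K\<close>, away from the origin. The second inequality extends
  to the interior of \<open>K\<close>: a point of \<open>K\<close> in the convex sublevel set \<open>f + \<alpha>\<parallel>\<cdot>\<parallel> \<le> 0\<close> could be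
  joined inside this set to a point of \<open>-C\<close>, which lies outside \<open>K\<close>, and the segment would
  cross \<open>bd K\<close>. Both claims then follow, the second one by the triangle inequality.

  The functional is found, as in the Hahn-Banach theorem, as a minimal sublinear functional.
\<close>

subsection \<open>Sublinear functionals and separation\<close>

definition sublinear :: "('a::real_vector \<Rightarrow> real) \<Rightarrow> bool" where
  "sublinear p \<longleftrightarrow> (\<forall>x y. p (x + y) \<le> p x + p y) \<and> (\<forall>t x. 0 \<le> t \<longrightarrow> p (t *\<^sub>R x) = t * p x)"

lemma sublinear_add: "sublinear p \<Longrightarrow> p (x + y) \<le> p x + p y"
  and sublinear_scaleR: "sublinear p \<Longrightarrow> 0 \<le> t \<Longrightarrow> p (t *\<^sub>R x) = t * p x"
  by (auto simp: sublinear_def)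

lemma sublinear_0: "sublinear p \<Longrightarrow> p 0 = 0"
  using sublinear_scaleR[of p 0 0] by simp

lemma sublinear_minus: "sublinear p \<Longrightarrow> - p (- x) \<le> p x"
  using sublinear_add[of p x "- x"] sublinear_0[of p] by simp

text \<open>The reverse inequality is the same estimate with \<open>inverse t\<close>, and the two
  one-sided bounds at 0 force \<open>p 0 = 0\<close>. One-sided estimates are what functionals
  defined as infima provide directly.\<close>

lemma sublinearI:
  assumes add: "\<And>x y. p (x + y) \<le> p x + p y"
    and scale: "\<And>t x. 0 < t \<Longrightarrow> p (t *\<^sub>R x) \<le> t * p x"
  shows "sublinear p"
proof -
  have "p 0 = 0"
    using add[of 0 0] scale[of "1/2" 0] by simp
  moreover have "p (t *\<^sub>R x) = t * p x" if "0 < t" for t x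
  proof (rule antisym)
    have "p (inverse t *\<^sub>R (t *\<^sub>R x)) \<le> inverse t * p (t *\<^sub>R x)"
      using that by (intro scale) simp
    then show "t * p x \<le> p (t *\<^sub>R x)"
      using that by (simp add: field_simps)
  qed (use scale that in simp)
  ultimately have "p (t *\<^sub>R x) = t * p x" if "0 \<le> t" for t x
    using that by (cases "t = 0") auto
  with add show ?thesis
    by (simp add: sublinear_def)
qed

lemma sublinear_norm: "sublinear norm"
  by (rule sublinearI) (auto simp: norm_triangle_ineq)

text \<open>The witness is the infimum of \<open>p (x + t *\<^sub>R s) - t * \<delta>\<close> over
  \<open>t \<ge> 0\<close> and \<open>s \<in> S\<close>: \<open>t = 0\<close> puts it below
  \<open>p\<close>, and \<open>t = 1\<close> at \<open>- s\<close> gives the bound. A singleton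
  \<open>S\<close> serves to make minimal functionals odd; \<open>p = norm\<close> serves the
  separation.\<close>

lemma sublinear_below_convex:
  fixes p :: "'a::real_vector \<Rightarrow> real"
  assumes p: "sublinear p" and S: "convex S" "S \<noteq> {}" and ge: "\<And>s. s \<in> S \<Longrightarrow> \<delta> \<le> p s"
  obtains q where "sublinear q" "q \<le> p" "\<And>s. s \<in> S \<Longrightarrow> q (- s) \<le> - \<delta>"
proof -
  define V where "V x = {p (x + t *\<^sub>R s) - t * \<delta> | t s. 0 \<le> t \<and> s \<in> S}" for x
  define q where "q x = Inf (V x)" for x
  have VI: "p (x + t *\<^sub>R s) - t * \<delta> \<in> V x" if "0 \<le> t" "s \<in> S" for x t s
    using that by (auto simp: V_def)
  have ne: "V x \<noteq> {}" for x
    using VI[of 0] S by blast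
  \<comment> \<open>Here the hypothesis \<open>\<delta> \<le> p s\<close> enters: it keeps the
    infimum finite.\<close>
  have lower: "- p (- x) \<le> v" if "v \<in> V x" for x v
  proof -
    from that obtain t s where v: "v = p (x + t *\<^sub>R s) - t * \<delta>" "0 \<le> t" "s \<in> S"
      by (auto simp: V_def)
    have "p (t *\<^sub>R s) \<le> p (x + t *\<^sub>R s) + p (- x)"
      using sublinear_add[OF p, of "x + t *\<^sub>R s" "- x"] by simp
    moreover have "t * \<delta> \<le> p (t *\<^sub>R s)"
      using v ge by (simp add: sublinear_scaleR[OF p] mult_left_mono)
    ultimately show ?thesis using v by simp
  qed
  have qI: "q x \<le> v" if "v \<in> V x" for x v
    unfolding q_def using that lower by (intro cInf_lower bdd_belowI)
  have V_add: "\<exists>w\<in>V (x + y). w \<le> u + v" if "u \<in> V x" "v \<in> V y" for x y u v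
  proof -
    from that obtain t s t' s' where
      u: "u = p (x + t *\<^sub>R s) - t * \<delta>" "0 \<le> t" "s \<in> S" and
      v: "v = p (y + t' *\<^sub>R s') - t' * \<delta>" "0 \<le> t'" "s' \<in> S"
      by (auto simp: V_def)
    \<comment> \<open>Convexity puts the weighted mean of \<open>s\<close> and \<open>s'\<close>
      into \<open>S\<close>; if both weights vanish, any point of \<open>S\<close> serves.\<close>
    obtain r where r: "r \<in> S" "(t + t') *\<^sub>R r = t *\<^sub>R s + t' *\<^sub>R s'"
    proof (cases "t + t' = 0")
      case True
      then have "t = 0" "t' = 0" using u v by auto
      then show ?thesis using that u by auto
    next
      case False
      then have pos: "0 < t + t'" using u v by simp
      have "(t / (t + t')) *\<^sub>R s + (t' / (t + t')) *\<^sub>R s' \<in> S"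
        using u v pos by (intro convexD[OF S(1)]) (auto simp: add_divide_distrib[symmetric])
      then show ?thesis
        using that pos by (simp add: scaleR_add_right)
    qed
    have "p ((x + y) + (t + t') *\<^sub>R r) \<le> p (x + t *\<^sub>R s) + p (y + t' *\<^sub>R s')"
      using sublinear_add[OF p, of "x + t *\<^sub>R s" "y + t' *\<^sub>R s'"] r(2) by (simp add: algebra_simps)
    then show ?thesis
      using VI[of "t + t'" r "x + y"] u v r(1) by (force simp: algebra_simps)
  qed
  have "sublinear q"
  proof (rule sublinearI)
    fix x y
    have "q (x + y) - u \<le> v" if "u \<in> V x" "v \<in> V y" for u v
      using V_add[OF that] qI by fastforce
    then have "q (x + y) - u \<le> q y" if "u \<in> V x" for u
      unfolding q_def[of y] using that ne by (intro cInf_greatest) auto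
    then have "q (x + y) - q y \<le> u" if "u \<in> V x" for u
      using that by fastforce
    then have "q (x + y) - q y \<le> q x"
      unfolding q_def[of x] using ne by (intro cInf_greatest) auto
    then show "q (x + y) \<le> q x + q y" by simp
  next
    fix c :: real and x
    assume c: "0 < c"
    have "q (c *\<^sub>R x) / c \<le> v" if "v \<in> V x" for v
    proof -
      from that obtain t s where v: "v = p (x + t *\<^sub>R s) - t * \<delta>" "0 \<le> t" "s \<in> S"
        by (auto simp: V_def)
      have "p (c *\<^sub>R x + (c * t) *\<^sub>R s) = c * p (x + t *\<^sub>R s)"
        using c sublinear_scaleR[OF p, of c "x + t *\<^sub>R s"] by (simp add: scaleR_add_right)
      then have "q (c *\<^sub>R x) \<le> c * v"
        using qI[OF VI[of "c * t" s "c *\<^sub>R x"]] v(2,3) c unfolding v(1)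
        by (simp add: right_diff_distrib)
      then show ?thesis using c by (simp add: field_simps)
    qed
    then have "q (c *\<^sub>R x) / c \<le> q x"
      unfolding q_def[of x] using ne by (intro cInf_greatest) auto
    then show "q (c *\<^sub>R x) \<le> c * q x" using c by (simp add: field_simps)
  qed
  moreover have "q \<le> p"
  proof (rule le_funI)
    fix x
    obtain s where "s \<in> S" using S by blast
    then show "q x \<le> p x" using qI[OF VI[of 0 s x]] by simp
  qed
  moreover have "q (- s) \<le> - \<delta>" if "s \<in> S" for s
    using qI[OF VI[of 1 s "- s"]] that sublinear_0[OF p] by simp
  ultimately show ?thesis using that by blast
qed

text \<open>Lowering \<open>q\<close> along the singleton \<open>{y}\<close> at level
  \<open>q y\<close> cannot change it, by minimality, so \<open>q\<close> is odd. An odd subadditive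
  functional is additive, and oddness extends homogeneity to negative scalars.\<close>

lemma linear_if_minimal_sublinear:
  fixes q :: "'a::real_vector \<Rightarrow> real"
  assumes q: "sublinear q" and min: "\<And>r. sublinear r \<Longrightarrow> r \<le> q \<Longrightarrow> r = q"
  shows "linear q"
proof -
  have odd: "q (- y) = - q y" for y
  proof (rule antisym)
    obtain r where "sublinear r" "r \<le> q" "r (- y) \<le> - q y"
      by (rule sublinear_below_convex[OF q, of "{y}" "q y"]) auto
    with min show "q (- y) \<le> - q y" by auto
    show "- q y \<le> q (- y)" using sublinear_minus[OF q, of y] by simp
  qed
  show ?thesis
  proof (rule linearI)
    fix x y
    have "q x \<le> q (x + y) + q (- y)"
      using sublinear_add[OF q, of "x + y" "- y"] by simp
    then show "q (x + y) = q x + q y"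
      using sublinear_add[OF q, of x y] odd[of y] by simp
  next
    fix t x
    show "q (t *\<^sub>R x) = t *\<^sub>R q x"
    proof (cases "0 \<le> t")
      case False
      then have "q ((- t) *\<^sub>R (- x)) = (- t) * q (- x)"
        by (intro sublinear_scaleR[OF q]) simp
      then show ?thesis by (simp add: odd)
    qed (simp add: sublinear_scaleR[OF q])
  qed
qed

text \<open>The pointwise infimum works: all members are bounded below by \<open>- p (- x)\<close>,
  and two members can be replaced by the smaller one, which makes the infimum subadditive.\<close>

lemma chain_sublinear_lower_bound:
  fixes F :: "('a::real_vector \<Rightarrow> real) set"
  assumes F: "\<And>q. q \<in> F \<Longrightarrow> sublinear q \<and> q \<le> p" "F \<noteq> {}"
    and chain: "\<And>q r. q \<in> F \<Longrightarrow> r \<in> F \<Longrightarrow> q \<le> r \<or> r \<le> q"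
  obtains u where "sublinear u" "\<And>q. q \<in> F \<Longrightarrow> u \<le> q"
proof -
  define u where "u x = (INF q\<in>F. q x)" for x
  have "- p (- x) \<le> q x" if "q \<in> F" for q x
    using F(1)[OF that] sublinear_minus[of q x] le_funD[of q p "- x"] by fastforce
  then have "bdd_below ((\<lambda>q. q x) ` F)" for x
    by (rule bdd_belowI2)
  then have le: "u x \<le> q x" if "q \<in> F" for q x
    unfolding u_def using that by (intro cINF_lower)
  have greatest: "c \<le> u x" if "\<And>q. q \<in> F \<Longrightarrow> c \<le> q x" for c x
    unfolding u_def using that F(2) by (intro cINF_greatest)
  have "sublinear u"
  proof (rule sublinearI)
    fix x y
    have "u (x + y) \<le> q x + r y" if qr: "q \<in> F" "r \<in> F" for q r
    proof -
      obtain m where m: "m \<in> F" "m \<le> q" "m \<le> r" using chain[OF qr] qr by blast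
      have "u (x + y) \<le> m (x + y)" using m le by blast
      also have "\<dots> \<le> m x + m y" using F(1) m by (simp add: sublinear_add)
      also have "\<dots> \<le> q x + r y" using m by (intro add_mono) (auto dest: le_funD)
      finally show ?thesis .
    qed
    then have "u (x + y) - q x \<le> u y" if "q \<in> F" for q
      using that by (intro greatest) (force simp: diff_le_eq add.commute)
    then have "u (x + y) - u y \<le> u x"
      by (intro greatest) (force simp: diff_le_eq add.commute)
    then show "u (x + y) \<le> u x + u y" by simp
  next
    fix t :: real and x
    assume t: "0 < t"
    have "u (t *\<^sub>R x) / t \<le> u x"
    proof (rule greatest)
      fix q assume "q \<in> F"
      then show "u (t *\<^sub>R x) / t \<le> q x"
        using le[of q "t *\<^sub>R x"] F(1)[of q] t by (simp add: sublinear_scaleR field_simps)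
    qed
    then show "u (t *\<^sub>R x) \<le> t * u x" using t by (simp add: field_simps)
  qed
  with le that show ?thesis by (simp add: le_fun_def)
qed

lemma linear_below_sublinear:
  fixes p :: "'a::real_vector \<Rightarrow> real"
  assumes p: "sublinear p"
  obtains f where "linear f" "f \<le> p"
proof -
  define Q where "Q = {q. sublinear q \<and> q \<le> p}"
  \<comment> \<open>Zorn's lemma is applied to the reversed order, so upper bounds of chains are
    lower bounds of functionals; the empty chain is bounded by \<open>p\<close>.\<close>
  have "\<exists>m\<in>Q. \<forall>q\<in>Q. q \<le> m \<longrightarrow> q = m"
  proof (rule predicate_Zorn)
    show "partial_order_on Q (relation_of (\<lambda>q r. r \<le> q) Q)"
      by (rule partial_order_on_relation_ofI) auto
  next
    fix F assume "F \<in> Chains (relation_of (\<lambda>q r. r \<le> q) Q)"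
    then have F: "\<And>q r. q \<in> F \<Longrightarrow> r \<in> F \<Longrightarrow> q \<le> r \<or> r \<le> q" "F \<subseteq> Q"
      by (auto simp: Chains_def relation_of_def)
    show "\<exists>u\<in>Q. \<forall>q\<in>F. u \<le> q"
    proof (cases "F = {}")
      case True
      then show ?thesis using p by (auto simp: Q_def)
    next
      case False
      then obtain u where u: "sublinear u" "\<And>q. q \<in> F \<Longrightarrow> u \<le> q"
        using chain_sublinear_lower_bound[of F p] F unfolding Q_def by blast
      then have "u \<le> p" using False F(2) by (force simp: Q_def)
      with u show ?thesis by (auto simp: Q_def)
    qed
  qed
  then obtain m where m: "sublinear m" "m \<le> p"
    and min: "\<And>q. sublinear q \<Longrightarrow> q \<le> p \<Longrightarrow> q \<le> m \<Longrightarrow> q = m"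
    by (auto simp: Q_def)
  have "linear m"
    using m min by (intro linear_if_minimal_sublinear) (auto intro: order_trans)
  with m that show ?thesis by blast
qed

text \<open>\<open>S\<close> keeps a distance \<open>\<delta>\<close> from 0, so the norm can be
  lowered to a sublinear \<open>q\<close> with \<open>q (- s) \<le> - \<delta>\<close>. A linear
  \<open>f\<close> below \<open>q\<close> inherits this bound, and \<open>f \<le> norm\<close> makes
  it continuous.\<close>

lemma blinfun_separating_0:
  fixes S :: "'a::real_normed_vector set"
  assumes S: "convex S" "S \<noteq> {}" and "0 \<notin> closure S"
  obtains f :: "'a \<Rightarrow>\<^sub>L real" and \<delta> where "0 < \<delta>" "\<And>s. s \<in> S \<Longrightarrow> \<delta> \<le> blinfun_apply f s"
proof -
  obtain \<delta> where \<delta>: "0 < \<delta>" "\<And>s. s \<in> S \<Longrightarrow> \<delta> \<le> norm s"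
    using \<open>0 \<notin> closure S\<close> by (force simp: closure_approachable not_less)
  obtain q where q: "sublinear q" "q \<le> norm" "\<And>s. s \<in> S \<Longrightarrow> q (- s) \<le> - \<delta>"
    using sublinear_below_convex[OF sublinear_norm S \<delta>(2)] by blast
  obtain f where f: "linear f" "f \<le> q"
    using linear_below_sublinear[OF q(1)] .
  have neg: "f (- x) = - f x" for x
    using f(1) by (rule linear_neg)
  have le: "f x \<le> norm x" for x
    using order_trans[OF f(2) q(2)] by (simp add: le_fun_def)
  have "\<bar>f x\<bar> \<le> norm x" for x
    using le[of x] le[of "- x"] neg by simp
  then have "bounded_linear f"
    using linear_add[OF f(1)] linear_scale[OF f(1)]
    by (intro bounded_linear_intro[where K = 1]) auto
  moreover have "\<delta> \<le> f s" if "s \<in> S" for s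
    using q(3)[OF that] le_funD[OF f(2), of "- s"] neg by simp
  ultimately show ?thesis
    using that[of \<delta> "Blinfun f"] \<delta>(1) by (simp add: bounded_linear_Blinfun_apply)
qed

subsection \<open>Separation of cones\<close>

text \<open>The frontier is the intersection of the closures of \<open>K\<close> and of its
  complement, and both sets are stable under multiplication by \<open>c > 0\<close>, the complement
  because \<open>inverse c\<close> preserves \<open>K\<close>.\<close>

lemma frontier_cone_scaleR:
  fixes K :: "'a::real_normed_vector set"
  assumes K: "cone K" and x: "x \<in> frontier K" and c: "0 < c"
  shows "c *\<^sub>R x \<in> frontier K"
proof -
  have scale: "c *\<^sub>R x \<in> closure S" if "x \<in> closure S" "\<And>y. y \<in> S \<Longrightarrow> c *\<^sub>R y \<in> S" for S
  proof -
    have "c *\<^sub>R x \<in> closure ((*\<^sub>R) c ` S)"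
      using that(1) by (auto simp flip: closure_scaleR)
    moreover have "(*\<^sub>R) c ` S \<subseteq> S" using that(2) by blast
    ultimately show ?thesis using closure_mono by blast
  qed
  have "c *\<^sub>R y \<in> - K" if "y \<in> - K" for y
  proof
    assume "c *\<^sub>R y \<in> K"
    then have "inverse c *\<^sub>R (c *\<^sub>R y) \<in> K" by (rule mem_cone[OF K]) (use c in simp)
    moreover have "inverse c *\<^sub>R (c *\<^sub>R y) = y" using c by simp
    ultimately have "y \<in> K" by metis
    with that show False by simp
  qed
  moreover have "c *\<^sub>R y \<in> K" if "y \<in> K" for y
    using c that by (intro mem_cone[OF K]) auto
  ultimately show ?thesis using x scale[of K] scale[of "- K"] by (simp add: frontier_closures)
qed

lemma SSP_separation:
  fixes C K :: "'a::real_normed_vector set"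
  assumes C: "nontrivial_cone C" and ssp: "SSP (uminus ` C) K"
  obtains f :: "'a \<Rightarrow>\<^sub>L real" and \<alpha> where "0 < \<alpha>" "\<And>c. c \<in> C \<Longrightarrow> norm c = 1 \<Longrightarrow> \<alpha> < blinfun_apply f c"
    "\<And>k. k \<in> frontier K \<Longrightarrow> norm k = 1 \<Longrightarrow> 0 < blinfun_apply f k + \<alpha>"
proof -
  let ?W = "wedge_part (uminus ` C)" and ?V = "vee_part K"
  obtain c where c: "c \<in> C" "c \<noteq> 0"
    using C by (auto simp: nontrivial_cone_def)
  then have "inverse (norm c) *\<^sub>R c \<in> C"
    using C by (auto simp: nontrivial_cone_def cone_def)
  then have cW: "- (inverse (norm c) *\<^sub>R c) \<in> ?W"
    unfolding wedge_part_def using c by (intro hull_inc) auto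
  have V0: "0 \<in> ?V"
    unfolding vee_part_def by (intro hull_inc) simp
  have "convex (\<Union>x\<in>?W. \<Union>y\<in>?V. {x - y})"
    by (intro convex_differences) (auto simp: wedge_part_def vee_part_def)
  moreover have eq: "(\<Union>x\<in>?W. \<Union>y\<in>?V. {x - y}) = {a - b | a b. a \<in> ?W \<and> b \<in> ?V}"
    by auto
  ultimately have "convex {a - b | a b. a \<in> ?W \<and> b \<in> ?V}" by simp
  moreover have "{a - b | a b. a \<in> ?W \<and> b \<in> ?V} \<noteq> {}"
    using cW V0 by blast
  moreover have "0 \<notin> closure {a - b | a b. a \<in> ?W \<and> b \<in> ?V}"
    using ssp by (simp add: SSP_def)
  ultimately obtain h :: "'a \<Rightarrow>\<^sub>L real" and \<delta> where \<delta>: "0 < \<delta>"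
    and h: "\<And>s. s \<in> {a - b | a b. a \<in> ?W \<and> b \<in> ?V} \<Longrightarrow> \<delta> \<le> blinfun_apply h s"
    by (rule blinfun_separating_0) blast
  have sep: "h v + \<delta> \<le> h w" if "w \<in> ?W" "v \<in> ?V" for v w
  proof -
    have "\<delta> \<le> h (w - v)" using that by (intro h) blast
    then show ?thesis by (simp add: blinfun.diff_right)
  qed
  define s where "s = (INF w\<in>?W. h w)"
  have s_le: "s \<le> h w" if "w \<in> ?W" for w
    unfolding s_def using that sep[OF _ V0]
    by (intro cINF_lower) (auto intro!: bdd_belowI2[where m = "h 0 + \<delta>"])
  have s_ge: "h v + \<delta> \<le> s" if "v \<in> ?V" for v
    unfolding s_def using that sep cW by (intro cINF_greatest) auto
  show ?thesis
  proof
    \<comment> \<open>The functional is \<open>- h\<close>, since \<open>h\<close> is the larger on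
      \<open>?W\<close>. The level \<open>\<alpha> = s - \<delta> / 2\<close> lies
      \<open>\<delta> / 2\<close> below the infimum \<open>s\<close> of \<open>h\<close> on
      \<open>?W\<close> and at least \<open>\<delta> / 2\<close> above all values on
      \<open>?V\<close>. The origin adjoined in \<open>vee_part\<close> gives
      \<open>s \<ge> \<delta>\<close>, hence \<open>\<alpha> > 0\<close>.\<close>
    show "0 < s - \<delta> / 2"
      using s_ge[OF V0] \<delta> by simp
    show "s - \<delta> / 2 < blinfun_apply (- h) c" if "c \<in> C" "norm c = 1" for c
    proof -
      have "- c \<in> ?W"
        unfolding wedge_part_def using that by (intro hull_inc) auto
      then show ?thesis
        using s_le[of "- c"] \<delta> by (simp add: blinfun.minus_right blinfun.minus_left)
    qed
    show "0 < blinfun_apply (- h) k + (s - \<delta> / 2)" if "k \<in> frontier K" "norm k = 1" for k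
    proof -
      have "k \<in> ?V"
        unfolding vee_part_def using that by (intro hull_inc) auto
      then show ?thesis
        using s_ge[of k] \<delta> by (simp add: blinfun.minus_left)
    qed
  qed
qed

text \<open>Homogeneity carries the inequalities from the unit sphere to \<open>C\<close> and to
  \<open>frontier K\<close>; the crossing argument then reaches the rest of
  \<open>K\<close>.\<close>

lemma SSP_aug_dual_separation:
  fixes C K :: "'a::real_normed_vector set"
  assumes C: "nontrivial_cone C" and K: "cone K" and ssp: "SSP (uminus ` C) K"
    and KC: "K \<inter> uminus ` C = {0}"
  obtains f :: "'a \<Rightarrow>\<^sub>L real" and \<alpha> where "(f, \<alpha>) \<in> aug_dual_sharp C"
    "\<And>k. k \<in> K \<Longrightarrow> k \<noteq> 0 \<Longrightarrow> 0 < blinfun_apply f k + \<alpha> * norm k"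
proof -
  obtain f :: "'a \<Rightarrow>\<^sub>L real" and \<alpha> where \<alpha>: "0 < \<alpha>"
    and f1: "\<And>c. c \<in> C \<Longrightarrow> norm c = 1 \<Longrightarrow> \<alpha> < blinfun_apply f c"
    and f2: "\<And>k. k \<in> frontier K \<Longrightarrow> norm k = 1 \<Longrightarrow> 0 < blinfun_apply f k + \<alpha>"
    using SSP_separation[OF C ssp] by metis
  have posC: "\<alpha> * norm c < f c" if "c \<in> C" "c \<noteq> 0" for c
  proof -
    have "inverse (norm c) *\<^sub>R c \<in> C"
      using C that by (auto simp: nontrivial_cone_def cone_def)
    with f1[OF this] that show ?thesis
      by (simp add: blinfun.scaleR_right field_simps)
  qed
  have posK: "0 < f k + \<alpha> * norm k" if "k \<in> frontier K" "k \<noteq> 0" for k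
  proof -
    have "inverse (norm k) *\<^sub>R k \<in> frontier K"
      using that by (intro frontier_cone_scaleR[OF K]) auto
    from f2[OF this] that show ?thesis
      by (simp add: blinfun.scaleR_right field_simps)
  qed
  have posC': "0 < f c" if "c \<in> C" "c \<noteq> 0" for c
  proof -
    have "0 \<le> \<alpha> * norm c" using \<alpha> by simp
    then show ?thesis using posC[OF that] by linarith
  qed
  have "0 < f k + \<alpha> * norm k" if k: "k \<in> K" "k \<noteq> 0" for k
  proof (rule ccontr)
    assume "\<not> 0 < f k + \<alpha> * norm k"
    then have fk: "f k + \<alpha> * norm k \<le> 0" by simp
    obtain c where c: "c \<in> C" "c \<noteq> 0"
      using C by (auto simp: nontrivial_cone_def)
    then have "- c \<in> uminus ` C" "- c \<noteq> 0" by auto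
    then have "- c \<notin> K" using KC by blast
    have "closed_segment k (- c) \<inter> frontier K \<noteq> {}"
      using k \<open>- c \<notin> K\<close> by (intro connected_Int_frontier) auto
    then obtain p where p: "p \<in> closed_segment k (- c)" "p \<in> frontier K" by blast
    then obtain t where t: "0 \<le> t" "t \<le> 1" "p = (1 - t) *\<^sub>R k + t *\<^sub>R (- c)"
      by (auto simp: in_segment)
    \<comment> \<open>Convexity of \<open>f + \<alpha> * norm\<close> keeps the crossing point in
      the sublevel set, both endpoints being there.\<close>
    have "f p + \<alpha> * norm p \<le> (1 - t) * (f k + \<alpha> * norm k) + t * (f (- c) + \<alpha> * norm c)"
    proof -
      have "norm p \<le> (1 - t) * norm k + t * norm c"
        using norm_triangle_ineq[of "(1 - t) *\<^sub>R k" "t *\<^sub>R (- c)"] t by simp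
      then have "\<alpha> * norm p \<le> \<alpha> * ((1 - t) * norm k + t * norm c)"
        using \<alpha> by simp
      moreover have "f p = (1 - t) * f k + t * f (- c)"
        unfolding t(3) by (simp only: blinfun.add_right blinfun.scaleR_right real_scaleR_def)
      ultimately show ?thesis by (simp add: algebra_simps)
    qed
    also have "\<dots> \<le> 0"
    proof (rule add_nonpos_nonpos)
      show "(1 - t) * (f k + \<alpha> * norm k) \<le> 0"
        using fk t by (simp add: mult_nonneg_nonpos)
      show "t * (f (- c) + \<alpha> * norm c) \<le> 0"
        using posC[OF c] t by (simp add: mult_nonneg_nonpos blinfun.minus_right)
    qed
    finally have "f p + \<alpha> * norm p \<le> 0" .
    \<comment> \<open>The segment may still cross the frontier at the origin, where
      \<open>posK\<close> says nothing. Then \<open>(1 - t) *\<^sub>R k = t *\<^sub>R c\<close>,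
      which is impossible because \<open>f\<close> is negative at \<open>k\<close> and positive at
      \<open>c\<close>.\<close>
    with posK p(2) have "p = 0" by fastforce
    have "0 < \<alpha> * norm k" using \<alpha> k by simp
    then have "f k < 0" using fk by linarith
    moreover have "(1 - t) * f k = t * f c"
    proof -
      have "f ((1 - t) *\<^sub>R k) = f (t *\<^sub>R c)" using t(3) \<open>p = 0\<close> by simp
      then show ?thesis by (simp only: blinfun.scaleR_right real_scaleR_def)
    qed
    moreover have "0 < f c" using posC' c by blast
    moreover have "(1 - t) * f k \<le> 0"
      using \<open>f k < 0\<close> t by (intro mult_nonneg_nonpos) auto
    ultimately show False
      using t(1) by (cases "t = 0") (auto simp: mult_le_0_iff)
  qed
  moreover have "(f, \<alpha>) \<in> aug_dual_sharp C"
    using \<alpha> posC posC' by (auto simp: aug_dual_sharp_def dual_sharp_def)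
  ultimately show ?thesis using that by blast
qed

section \<open>From cone separation to exact and approximate minimality\<close>

theorem theorem4p1:
  fixes C A D :: "'a::real_normed_vector set" and x\<^sub>0 :: 'a and \<epsilon> :: real
  assumes "nontrivial_cone C" and "closed C" and "convex C" and "pointed C"
    and "x\<^sub>0 \<in> A"
    and "0 \<le> \<epsilon>"
    and "D \<in> H_bar C"
    and "SSP (uminus ` C) (closure (cone hull ((\<lambda>a. a - x\<^sub>0) ` A + dil D \<epsilon>)))"
    and "x\<^sub>0 \<in> Be A C D \<epsilon>"
  shows "\<exists>(f, \<alpha>) \<in> aug_dual_sharp C.
           {x. is_arg_min (\<lambda>x. blinfun_apply f (x - x\<^sub>0) + \<alpha> * norm (x - x\<^sub>0))
                 (\<lambda>x. x \<in> (A + dil D \<epsilon>) \<union> {x\<^sub>0}) x} = {x\<^sub>0}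
         \<and> x\<^sub>0 \<in> AMin (g_fun f \<alpha> x\<^sub>0) A
                 (INF d\<in>dil D \<epsilon>. blinfun_apply f d + \<alpha> * norm d)"
proof -
  define M where "M = (\<lambda>y. y - x\<^sub>0) ` (A + dil D \<epsilon>)"
  define K where "K = closure (cone hull M)"
  \<comment> \<open>The SSP hypothesis translates \<open>A\<close> before adding
    \<open>dil D \<epsilon>\<close>, Benson efficiency afterwards; the sets agree.\<close>
  have "(\<lambda>a. a - x\<^sub>0) ` A + dil D \<epsilon> = M"
    by (force simp: M_def set_plus_def image_iff)
  then have ssp: "SSP (uminus ` C) K"
    using assms by (simp add: K_def)
  have KC: "K \<inter> uminus ` C = {0}"
    using assms by (simp add: K_def M_def Be_def)
  have "cone K"
    by (simp add: K_def cone_closure cone_cone_hull)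
  then obtain f :: "'a \<Rightarrow>\<^sub>L real" and \<alpha> where f: "(f, \<alpha>) \<in> aug_dual_sharp C"
    and pos: "\<And>k. k \<in> K \<Longrightarrow> k \<noteq> 0 \<Longrightarrow> 0 < blinfun_apply f k + \<alpha> * norm k"
    using SSP_aug_dual_separation[OF \<open>nontrivial_cone C\<close> _ ssp KC] by metis
  have \<alpha>: "0 < \<alpha>" using f by (simp add: aug_dual_sharp_def)
  have MK: "x - x\<^sub>0 \<in> K" if "x \<in> A + dil D \<epsilon>" for x
    using that hull_subset[of M cone] closure_subset[of "cone hull M"] by (auto simp: K_def M_def)
  have pos': "0 < f (x - x\<^sub>0) + \<alpha> * norm (x - x\<^sub>0)" if "x \<in> A + dil D \<epsilon>" "x \<noteq> x\<^sub>0" for x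
    using pos[OF MK] that by simp
  \<comment> \<open>The objective vanishes at \<open>x\<^sub>0\<close> and is positive at every
    other feasible point.\<close>
  have "{x. is_arg_min (\<lambda>x. blinfun_apply f (x - x\<^sub>0) + \<alpha> * norm (x - x\<^sub>0))
                 (\<lambda>x. x \<in> (A + dil D \<epsilon>) \<union> {x\<^sub>0}) x} = {x\<^sub>0}"
    using pos' by (fastforce simp: is_arg_min_def)
  moreover have "x\<^sub>0 \<in> AMin (g_fun f \<alpha> x\<^sub>0) A (INF d\<in>dil D \<epsilon>. blinfun_apply f d + \<alpha> * norm d)"
  proof -
    have D: "D \<noteq> {}" "0 \<notin> D" using \<open>D \<in> H_bar C\<close> by (auto simp: H_bar_def)
    \<comment> \<open>For \<open>\<epsilon> = 0\<close>, \<open>D\<close> itself survives the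
      removal of 0. Nonemptiness makes the infimum a greatest lower bound.\<close>
    then have ne: "dil D \<epsilon> \<noteq> {}"
      using hull_subset[of D cone] by (auto simp: dil_def)
    have "- g_fun f \<alpha> x\<^sub>0 z \<le> f d + \<alpha> * norm d" if "z \<in> A" "d \<in> dil D \<epsilon>" for z d
    proof -
      have "z + d \<in> A + dil D \<epsilon>" using that by (rule set_plus_intro)
      then have "0 \<le> f (z + d - x\<^sub>0) + \<alpha> * norm (z + d - x\<^sub>0)"
        \<comment> \<open>If \<open>z + d = x\<^sub>0\<close>, the value is 0, so only the weak
          inequality holds in general.\<close>
        using pos'[of "z + d"] by (cases "z + d = x\<^sub>0") auto
      also have "f (z + d - x\<^sub>0) = f (z - x\<^sub>0) + f d"
        by (simp add: blinfun.diff_right blinfun.add_right)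
      also have "norm (z + d - x\<^sub>0) \<le> norm (z - x\<^sub>0) + norm d"
        using norm_triangle_ineq[of "z - x\<^sub>0" d] by (simp add: algebra_simps)
      finally show ?thesis
        using \<alpha> by (simp add: g_fun_def algebra_simps)
    qed
    then have "- g_fun f \<alpha> x\<^sub>0 z \<le> (INF d\<in>dil D \<epsilon>. f d + \<alpha> * norm d)" if "z \<in> A" for z
      using ne that by (intro cINF_greatest)
    \<comment> \<open>Since \<open>g_fun\<close> vanishes at \<open>x\<^sub>0\<close>, the bound
      just shown is the required inequality.\<close>
    then show ?thesis
      using \<open>x\<^sub>0 \<in> A\<close> by (fastforce simp: AMin_def g_fun_def)
  qed
  ultimately show ?thesis using f by blast
qed

end
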